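(* Let $p\ge2$ and let $m_1,\dots,m_p$ be positive integers. The set $\mathcal{S}^p$ is divided into $2^{p-1}$ orbits, the points of each orbit having the same index. For $(\delta_1,\dots,\delta_{p-1})\in\{0,1\}^{p-1}$, the orbit $S_{(\delta_1,\dots,\delta_{p-1})}=\{P\in\mathcal{S}^p: I(P)=(\delta_1,\dots,\delta_{p-1})\}$ satisfies, with $\delta_0=0$, \[|S_{(\delta_1,\dots,\delta_{p-1})}|=\prod_{i=1}^{p}\frac{(m_i+1)+(-1)^{[\delta_{i-1}]_2}[m_i+1]_2}{2}+\prod_{i=1}^{p}\frac{(m_i+1)+(-1)^{[\delta_{i-1}+1]_2}[m_i+1]_2}{2}.\]
   Context: $\mathcal{S}^p=\{(x_1,\dots,x_p)\in\mathbb{Z}^p: 0\le x_i\le m_i\}$. A diagonal move takes $P\in\mathcal{S}^p$ to $Q\in\mathcal{S}^p$ with $Q-P\in\{\pm1\}^p$; orbits are the classes of points mutually reachable by finite sequences of diagonal moves (equivalently, orbits of the group generated by the maps $(x_i)_i\mapsto(\varphi_{m_i}(x_i\pm1))_i$ with independent signs, $\varphi_m(u)=\min_{n\in\mathbb{Z}}|u-2nm|$). For an integer $a$, $[a]_2\in\{0,1\}$ denotes its residue mod $2$. The index of $P=(x_1,\dots,x_p)$ is $I(P)=([x_1+x_2]_2,\dots,[x_1+x_p]_2)$. *)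

theory Defs
  imports Complex_Main "HOL-Library.FuncSet" "HOL-Library.Disjoint_Sets"
begin

definition res2 :: "int \<Rightarrow> nat" where
  "res2 a = nat (a mod 2)"

text \<open>
  A tuple \<open>(x\<^sub>1, \<dots>, x\<^sub>n)\<close> is a function on \<open>nat\<close> that is extensional on \<open>{1..n}\<close>, so that
  two tuples are equal as functions exactly if they agree in all entries.
\<close>

definition grid :: "nat \<Rightarrow> (nat \<Rightarrow> nat) \<Rightarrow> (nat \<Rightarrow> int) set" where
  "grid p m = (\<Pi>\<^sub>E i\<in>{1..p}. {0..int (m i)})"

definition diag_moves :: "nat \<Rightarrow> (nat \<Rightarrow> nat) \<Rightarrow> ((nat \<Rightarrow> int) \<times> (nat \<Rightarrow> int)) set" where
  "diag_moves p m =
     {(P, Q). P \<in> grid p m \<and> Q \<in> grid p m \<and> (\<forall>i\<in>{1..p}. Q i - P i \<in> {1, -1})}"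

definition mutually_reachable ::
  "nat \<Rightarrow> (nat \<Rightarrow> nat) \<Rightarrow> ((nat \<Rightarrow> int) \<times> (nat \<Rightarrow> int)) set" where
  "mutually_reachable p m =
     {(P, Q). P \<in> grid p m \<and> Q \<in> grid p m \<and>
        (P, Q) \<in> (diag_moves p m)\<^sup>* \<and> (Q, P) \<in> (diag_moves p m)\<^sup>*}"

definition orbits :: "nat \<Rightarrow> (nat \<Rightarrow> nat) \<Rightarrow> (nat \<Rightarrow> int) set set" where
  "orbits p m = grid p m // mutually_reachable p m"

definition index :: "nat \<Rightarrow> (nat \<Rightarrow> int) \<Rightarrow> (nat \<Rightarrow> nat)" where
  "index p P = (\<lambda>j\<in>{1..p - 1}. res2 (P 1 + P (j + 1)))"

definition index_class :: "nat \<Rightarrow> (nat \<Rightarrow> nat) \<Rightarrow> (nat \<Rightarrow> nat) \<Rightarrow> (nat \<Rightarrow> int) set" where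
  "index_class p m \<delta> = {P \<in> grid p m. index p P = \<delta>}"

end

(* Two grid points have the same index iff their difference is constant mod 2. Diagonal moves
   change every coordinate by an odd amount, so they preserve the index. Conversely, if P - Q is
   even in every coordinate, two moves bring P closer to Q in each coordinate where they differ:
   the differing coordinates advance by 2, the others step away and back, which needs m i > 0. If
   P - Q is odd in every coordinate, one arbitrary move reduces to the even case. So the orbits are
   exactly the index classes. Each class is the disjoint union of two boxes with a prescribed parity
   in every coordinate, according to the parity of the first coordinate. *)

theory Submission imports Defs begin

section \<open>Residues modulo 2 and the index\<close>

lemma res2_if: "res2 a = (if even a then 0 else 1)"
  by (simp add: res2_def mod_2_eq_odd)

lemma res2_eq_iff: "res2 a = res2 b \<longleftrightarrow> even (a - b)"
  by (simp add: res2_if)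

lemma even_diff_res2: "even (a - int (res2 a))"
  by (simp add: res2_if)

lemma res2_of_nat: "res2 (int k) = k mod 2"
  by (simp add: res2_def nat_mod_distrib)

text \<open>The index only involves the coordinates from 2 on, but at \<open>i = 1\<close> the
  difference is twice \<open>P 1 - Q 1\<close>, hence even. So the condition can range over all of
  \<open>{1..p}\<close> and the index shift disappears.\<close>

lemma index_eq_iff:
  "index p P = index p Q \<longleftrightarrow> (\<forall>i\<in>{1..p}. even ((P 1 + P i) - (Q 1 + Q i)))"
proof
  assume L: "index p P = index p Q"
  show "\<forall>i\<in>{1..p}. even ((P 1 + P i) - (Q 1 + Q i))"
  proof
    fix i assume i: "i \<in> {1..p}"
    show "even ((P 1 + P i) - (Q 1 + Q i))"
    proof (cases "i = 1")
      case False
      then have "index p P (i - 1) = index p Q (i - 1)" "i - 1 \<in> {1..p - 1}"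
        using i L by auto
      then show ?thesis using i by (simp add: index_def res2_eq_iff)
    qed simp
  qed
next
  assume R: "\<forall>i\<in>{1..p}. even ((P 1 + P i) - (Q 1 + Q i))"
  show "index p P = index p Q"
    unfolding index_def
  proof (rule restrict_ext)
    fix j assume "j \<in> {1..p - 1}"
    then have "j + 1 \<in> {1..p}" by auto
    with R show "res2 (P 1 + P (j + 1)) = res2 (Q 1 + Q (j + 1))"
      unfolding res2_eq_iff by blast
  qed
qed

lemma index_in_PiE: "index p P \<in> {1..p - 1} \<rightarrow>\<^sub>E {0, 1}"
  unfolding index_def by (auto simp: res2_if)

section \<open>Diagonal moves: reversibility and invariance of the index\<close>

lemma diag_moves_sym: "sym (diag_moves p m)"
proof (rule symI)
  fix P Q assume PQ: "(P, Q) \<in> diag_moves p m"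
  have "P i - Q i \<in> {1, -1}" if "i \<in> {1..p}" for i
  proof -
    have "Q i - P i \<in> {1, -1}" using PQ that by (auto simp: diag_moves_def)
    then show ?thesis by auto
  qed
  with PQ show "(Q, P) \<in> diag_moves p m" by (auto simp: diag_moves_def)
qed

text \<open>Every move can be undone by a move, so reachability in one direction already gives the
  other.\<close>

lemma mutually_reachable_alt:
  "mutually_reachable p m = {(P, Q). P \<in> grid p m \<and> Q \<in> grid p m \<and> (P, Q) \<in> (diag_moves p m)\<^sup>*}"
  using sym_rtrancl[OF diag_moves_sym, of p m]
  by (auto simp: mutually_reachable_def dest: symD)

lemma equiv_mutually_reachable: "equiv (grid p m) (mutually_reachable p m)"
  by (rule equivI)
    (auto simp: mutually_reachable_def refl_on_def sym_def trans_def intro: rtrancl_trans)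

lemma diag_moves_index:
  assumes "(P, Q) \<in> diag_moves p m"
  shows "index p P = index p Q"
  unfolding index_eq_iff
proof
  fix i assume i: "i \<in> {1..p}"
  then have "1 \<in> {1..p}" by auto
  with assms i have "Q i - P i \<in> {1, -1}" "Q 1 - P 1 \<in> {1, -1}"
    unfolding diag_moves_def by blast+
  then show "even ((P 1 + P i) - (Q 1 + Q i))" by (auto simp: algebra_simps) presburger+
qed

lemma reachable_index:
  assumes "(P, Q) \<in> (diag_moves p m)\<^sup>*"
  shows "index p P = index p Q"
  using assms by induction (auto dest: diag_moves_index)

section \<open>Connecting points of equal index\<close>

lemma grid_memD: "P \<in> grid p m \<Longrightarrow> i \<in> {1..p} \<Longrightarrow> 0 \<le> P i \<and> P i \<le> int (m i)"
  unfolding grid_def by (auto dest: PiE_mem)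

lemma restrict_in_grid:
  assumes "\<And>i. i \<in> {1..p} \<Longrightarrow> 0 \<le> f i \<and> f i \<le> int (m i)"
  shows "restrict f {1..p} \<in> grid p m"
  using assms unfolding grid_def by auto

lemma grid_ext:
  assumes "P \<in> grid p m" "Q \<in> grid p m" "\<And>i. i \<in> {1..p} \<Longrightarrow> P i = Q i"
  shows "P = Q"
  using assms unfolding grid_def by (rule PiE_ext)

text \<open>A unit step that is available at every point of \<open>{0..n}\<close> once
  \<open>n > 0\<close>: downwards, except at the lower end.\<close>

definition bounce :: "int \<Rightarrow> int" where
  "bounce x = (if x = 0 then 1 else x - 1)"

lemma bounce_bounds: "0 \<le> x \<Longrightarrow> x \<le> int n \<Longrightarrow> n > 0 \<Longrightarrow> 0 \<le> bounce x \<and> bounce x \<le> int n"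
  by (auto simp: bounce_def)

lemma bounce_diff: "bounce x - x \<in> {1, -1}"
  by (auto simp: bounce_def)

text \<open>\<open>N\<close> bounds half the largest coordinate distance. All coordinates advance
  simultaneously, so each pair of moves lowers this bound by one, which drives the induction;
  \<open>P\<close> varies and the target \<open>Q\<close> stays fixed.\<close>

lemma reachable_of_even:
  assumes pos: "\<forall>i\<in>{1..p}. m i > 0"
    and "P \<in> grid p m" "Q \<in> grid p m"
    and "\<And>i. i \<in> {1..p} \<Longrightarrow> even (Q i - P i)"
    and "\<And>i. i \<in> {1..p} \<Longrightarrow> \<bar>Q i - P i\<bar> \<le> 2 * int N"
  shows "(P, Q) \<in> (diag_moves p m)\<^sup>*"
  using assms(2-)
proof (induction N arbitrary: P)
  case 0
  have "P = Q" by (rule grid_ext[OF 0(1,2)]) (use 0(4) in fastforce)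
  then show ?case by simp
next
  case (Suc N)
  \<comment> \<open>\<open>P1\<close> is the halfway point. Coordinates that already agree bounce
    away and return in \<open>P2\<close>, where \<open>sgn 0 = 0\<close> leaves them
    unchanged.\<close>
  define P1 where
    "P1 = restrict (\<lambda>i. if P i = Q i then bounce (P i) else P i + sgn (Q i - P i)) {1..p}"
  define P2 where "P2 = restrict (\<lambda>i. P i + 2 * sgn (Q i - P i)) {1..p}"
  have bnd: "0 \<le> P i \<and> P i \<le> int (m i)" "0 \<le> Q i \<and> Q i \<le> int (m i)" "m i > 0"
    if "i \<in> {1..p}" for i
    using grid_memD[OF Suc.prems(1) that] grid_memD[OF Suc.prems(2) that] pos that by auto
  \<comment> \<open>An even nonzero difference has absolute value at least 2, so a step of 2 towards
    \<open>Q i\<close> never overshoots it; this keeps \<open>P1\<close> and \<open>P2\<close>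
    inside the grid.\<close>
  have far: "P i = Q i \<or> Q i - P i \<ge> 2 \<or> Q i - P i \<le> -2" if "i \<in> {1..p}" for i
    using Suc.prems(3)[OF that] by presburger
  have P1: "P1 \<in> grid p m"
    unfolding P1_def
  proof (rule restrict_in_grid)
    fix i assume i: "i \<in> {1..p}"
    show "0 \<le> (if P i = Q i then bounce (P i) else P i + sgn (Q i - P i)) \<and>
      (if P i = Q i then bounce (P i) else P i + sgn (Q i - P i)) \<le> int (m i)"
      using bnd[OF i] far[OF i] bounce_bounds[of "P i" "m i"] by (auto simp: sgn_if)
  qed
  have P2: "P2 \<in> grid p m"
    unfolding P2_def
  proof (rule restrict_in_grid)
    fix i assume i: "i \<in> {1..p}"
    show "0 \<le> P i + 2 * sgn (Q i - P i) \<and> P i + 2 * sgn (Q i - P i) \<le> int (m i)"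
      using bnd[OF i] far[OF i] by (auto simp: sgn_if)
  qed
  have "(P, P1) \<in> diag_moves p m"
    using Suc.prems(1) P1 bounce_diff by (auto simp: diag_moves_def P1_def sgn_if)
  moreover have "(P1, P2) \<in> diag_moves p m"
    using P1 P2 by (auto simp: diag_moves_def P1_def P2_def sgn_if bounce_def)
  moreover have "(P2, Q) \<in> (diag_moves p m)\<^sup>*"
  proof (rule Suc.IH[OF P2 Suc.prems(2)])
    fix i assume i: "i \<in> {1..p}"
    show "even (Q i - P2 i)" using Suc.prems(3)[OF i] i by (simp add: P2_def)
    show "\<bar>Q i - P2 i\<bar> \<le> 2 * int N"
      using Suc.prems(4)[OF i] far[OF i] i by (auto simp: P2_def sgn_if)
  qed
  ultimately show ?case by (meson converse_rtrancl_into_rtrancl)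
qed

lemma reachable_of_all_even:
  assumes "\<forall>i\<in>{1..p}. m i > 0" "P \<in> grid p m" "Q \<in> grid p m"
    and "\<And>i. i \<in> {1..p} \<Longrightarrow> even (Q i - P i)"
  shows "(P, Q) \<in> (diag_moves p m)\<^sup>*"
\<comment> \<open>The sum of the side lengths is a convenient bound valid for all coordinates at
  once.\<close>
proof (rule reachable_of_even[OF assms(1-3), where N = "\<Sum>i\<in>{1..p}. m i"])
  fix i assume i: "i \<in> {1..p}"
  have "m i \<le> (\<Sum>i\<in>{1..p}. m i)" using i by (intro member_le_sum) auto
  then show "\<bar>Q i - P i\<bar> \<le> 2 * int (\<Sum>i\<in>{1..p}. m i)"
    using grid_memD[OF assms(2) i] grid_memD[OF assms(3) i] by linarith
qed (use assms(4) in auto)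

lemma reachable_iff_index_eq:
  assumes pos: "\<forall>i\<in>{1..p}. m i > 0" and P: "P \<in> grid p m" and Q: "Q \<in> grid p m"
  shows "(P, Q) \<in> (diag_moves p m)\<^sup>* \<longleftrightarrow> index p P = index p Q"
proof
  assume "index p P = index p Q"
  then have idx: "even ((P 1 + P i) - (Q 1 + Q i))" if "i \<in> {1..p}" for i
    using that by (simp add: index_eq_iff)
  show "(P, Q) \<in> (diag_moves p m)\<^sup>*"
  proof (cases "even (Q 1 - P 1)")
    case True
    show ?thesis
    proof (rule reachable_of_all_even[OF pos P Q])
      show "even (Q i - P i)" if "i \<in> {1..p}" for i
        using idx[OF that] True by presburger
    qed
  next
    case False
    \<comment> \<open>Here all coordinate differences are odd. Bouncing every coordinate is a legal
      move that makes all of them even.\<close>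
    define R where "R = restrict (\<lambda>i. bounce (P i)) {1..p}"
    have R: "R \<in> grid p m"
      unfolding R_def
      by (rule restrict_in_grid) (use pos grid_memD[OF P] bounce_bounds in blast)
    have "(P, R) \<in> diag_moves p m"
      using P R bounce_diff by (auto simp: diag_moves_def R_def)
    moreover have "(R, Q) \<in> (diag_moves p m)\<^sup>*"
    proof (rule reachable_of_all_even[OF pos R Q])
      fix i assume i: "i \<in> {1..p}"
      have "R i - P i \<in> {1, -1}" using i bounce_diff by (simp add: R_def)
      then show "even (Q i - R i)" using idx[OF i] False by auto presburger+
    qed
    ultimately show ?thesis by (meson converse_rtrancl_into_rtrancl)
  qed
qed (rule reachable_index)

section \<open>Orbits are the index classes\<close>

lemma orbit_eq_index_class:
  assumes "\<forall>i\<in>{1..p}. m i > 0" "P \<in> grid p m"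
  shows "mutually_reachable p m `` {P} = index_class p m (index p P)"
  using assms reachable_iff_index_eq[OF assms(1)]
  by (auto simp: mutually_reachable_alt index_class_def)

lemma index_class_nonempty:
  assumes "\<forall>i\<in>{1..p}. m i > 0" "\<delta> \<in> {1..p - 1} \<rightarrow>\<^sub>E {0, 1}"
  shows "index_class p m \<delta> \<noteq> {}"
proof -
  \<comment> \<open>The witness is \<open>(0, \<delta> 1, ..., \<delta> (p - 1))\<close>. The update
    \<open>\<delta>(0 := 0)\<close> supplies the convention that the zeroth entry is 0, since the
    extensional \<open>\<delta>\<close> is \<open>undefined\<close> there. Entries are at most 1, so
    positive side lengths suffice.\<close>
  define P where "P = restrict (\<lambda>i. int ((\<delta>(0 := 0)) (i - 1))) {1..p}"
  have \<delta>: "\<delta> j = 0 \<or> \<delta> j = 1" if "j \<in> {1..p - 1}" for j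
    using PiE_mem[OF assms(2) that] by simp
  have "P \<in> grid p m"
    unfolding P_def
  proof (rule restrict_in_grid)
    fix i assume i: "i \<in> {1..p}"
    then have "i = 1 \<or> i - 1 \<in> {1..p - 1}" "m i > 0" using assms(1) by auto
    then show "0 \<le> int ((\<delta>(0 := 0)) (i - 1)) \<and> int ((\<delta>(0 := 0)) (i - 1)) \<le> int (m i)"
      using \<delta>[of "i - 1"] by auto
  qed
  moreover have "index p P = \<delta>"
  proof (rule PiE_ext[OF index_in_PiE assms(2)])
    fix j assume j: "j \<in> {1..p - 1}"
    then show "index p P j = \<delta> j"
      using \<delta>[OF j] by (auto simp: index_def P_def res2_def)
  qed
  ultimately show ?thesis by (auto simp: index_class_def)
qed

lemma orbits_eq_index_classes:
  assumes "\<forall>i\<in>{1..p}. m i > 0"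
  shows "orbits p m = index_class p m ` ({1..p - 1} \<rightarrow>\<^sub>E {0, 1})"
proof (intro equalityI subsetI)
  fix C assume "C \<in> orbits p m"
  then obtain P where "P \<in> grid p m" "C = mutually_reachable p m `` {P}"
    unfolding orbits_def by (auto elim: quotientE)
  then show "C \<in> index_class p m ` ({1..p - 1} \<rightarrow>\<^sub>E {0, 1})"
    using orbit_eq_index_class[OF assms] index_in_PiE by blast
next
  fix C assume "C \<in> index_class p m ` ({1..p - 1} \<rightarrow>\<^sub>E {0, 1})"
  then obtain \<delta> where \<delta>: "\<delta> \<in> {1..p - 1} \<rightarrow>\<^sub>E {0, 1}" "C = index_class p m \<delta>" by blast
  then obtain P where "P \<in> grid p m" "index p P = \<delta>"
    using index_class_nonempty[OF assms \<delta>(1)] by (auto simp: index_class_def)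
  then have "C = mutually_reachable p m `` {P}" "P \<in> grid p m"
    using orbit_eq_index_class[OF assms] \<delta> by auto
  then show "C \<in> orbits p m" unfolding orbits_def by (auto intro: quotientI)
qed

text \<open>Classes are nonempty, and any common point determines the index.\<close>

lemma inj_on_index_class:
  assumes "\<forall>i\<in>{1..p}. m i > 0"
  shows "inj_on (index_class p m) ({1..p - 1} \<rightarrow>\<^sub>E {0, 1})"
proof (rule inj_onI)
  fix \<delta> \<epsilon> assume "\<delta> \<in> {1..p - 1} \<rightarrow>\<^sub>E {0, 1}" "index_class p m \<delta> = index_class p m \<epsilon>"
  with index_class_nonempty[OF assms, of \<delta>]
  obtain P where "P \<in> index_class p m \<delta>" "P \<in> index_class p m \<epsilon>" by blast
  then show "\<delta> = \<epsilon>" by (simp add: index_class_def)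
qed

lemma card_orbits:
  assumes "\<forall>i\<in>{1..p}. m i > 0"
  shows "card (orbits p m) = 2 ^ (p - 1)"
  unfolding orbits_eq_index_classes[OF assms] card_image[OF inj_on_index_class[OF assms]]
  by (simp add: card_PiE numeral_2_eq_2)

lemma partition_on_orbits: "partition_on (grid p m) (orbits p m)"
  unfolding orbits_def using equiv_mutually_reachable by (rule partition_on_quotient)

section \<open>Counting integers of a given parity in an interval\<close>

definition parity_range :: "nat \<Rightarrow> nat \<Rightarrow> int set" where
  "parity_range n k = {x \<in> {0..int n}. even (x - int k)}"

lemma finite_parity_range: "finite (parity_range n k)"
  unfolding parity_range_def by (rule finite_subset[of _ "{0..int n}"]) auto

text \<open>For odd \<open>n\<close> both parities occur equally often in \<open>{0..n}\<close>; for
  even \<open>n\<close> there is one more even number than odd ones, which the sign term records. In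
  the induction the new point \<open>n + 1\<close> counts exactly if it has the parity of
  \<open>k\<close>. Only the parity of \<open>k\<close> matters, so \<open>k + 1\<close> gives the
  opposite parity without reduction modulo 2.\<close>

lemma card_parity_range:
  "real (card (parity_range n k)) = (real (n + 1) + (-1) ^ k * real (res2 (int (n + 1)))) / 2"
proof (induction n)
  case 0
  have "parity_range 0 k = (if even k then {0} else {})"
    by (auto simp: parity_range_def)
  then show ?case by (auto simp: res2_def)
next
  case (Suc n)
  have new: "int (Suc n) \<notin> parity_range n k"
    by (auto simp: parity_range_def)
  have le_Suc: "x \<le> int (Suc n) \<longleftrightarrow> x \<le> int n \<or> x = int (Suc n)" for x
    by auto
  have "parity_range (Suc n) k =
    (if even (Suc n + k) then insert (int (Suc n)) (parity_range n k) else parity_range n k)"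
    unfolding parity_range_def atLeastAtMost_iff le_Suc by auto
  then have "real (card (parity_range (Suc n) k)) =
    real (card (parity_range n k)) + (if even (Suc n + k) then 1 else 0)"
    using finite_parity_range new by simp
  moreover have "res2 (int (n + 1)) = (if even n then 1 else 0)"
    and "res2 (int (Suc n + 1)) = (if even n then 0 else 1)"
    by (auto simp: res2_if)
  ultimately show ?case unfolding Suc.IH by (auto simp: field_simps)
qed

section \<open>Index classes as disjoint unions of two boxes\<close>

lemma index_class_eq_parity_boxes:
  fixes p m \<delta>
  defines "e \<equiv> \<lambda>i. (\<delta>(0 := 0)) (i - 1)"
  assumes "p \<ge> 2" "\<delta> \<in> {1..p - 1} \<rightarrow>\<^sub>E {0, 1}"
  shows "index_class p m \<delta> =
    (\<Pi>\<^sub>E i\<in>{1..p}. parity_range (m i) (e i)) \<union> (\<Pi>\<^sub>E i\<in>{1..p}. parity_range (m i) (e i + 1))"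
proof -
  have idx: "index p P = \<delta> \<longleftrightarrow> (\<forall>i\<in>{1..p}. even (P 1 + P i - int (e i)))" for P
  proof
    assume P: "index p P = \<delta>"
    show "\<forall>i\<in>{1..p}. even (P 1 + P i - int (e i))"
    proof
      fix i assume i: "i \<in> {1..p}"
      show "even (P 1 + P i - int (e i))"
      proof (cases "i = 1")
        case False
        then have "i - 1 \<in> {1..p - 1}" "e i = \<delta> (i - 1)" using i by (auto simp: e_def)
        then have "e i = res2 (P 1 + P i)" using P False i by (auto simp: index_def)
        then show ?thesis by (metis even_diff_res2)
      qed (simp add: e_def)
    qed
  next
    assume P: "\<forall>i\<in>{1..p}. even (P 1 + P i - int (e i))"
    show "index p P = \<delta>"
    proof (rule PiE_ext[OF index_in_PiE assms(3)])
      fix j assume j: "j \<in> {1..p - 1}"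
      then have "j + 1 \<in> {1..p}" by auto
      with P have ev: "even (P 1 + P (j + 1) - int (e (j + 1)))" by blast
      have "e (j + 1) = \<delta> j" "\<delta> j \<in> {0, 1}"
        using j PiE_mem[OF assms(3) j] by (auto simp: e_def)
      with ev have "res2 (P 1 + P (j + 1)) = \<delta> j"
        by (auto simp: res2_if)
      then show "index p P j = \<delta> j" using j by (simp add: index_def)
    qed
  qed
  have one: "1 \<in> {1..p}" "e 1 = 0" using assms(2) by (auto simp: e_def)
  \<comment> \<open>For even \<open>P 1\<close> the condition says that \<open>P i\<close> has the
    parity of \<open>e i\<close>, for odd \<open>P 1\<close> the opposite one. Since
    \<open>e 1 = 0\<close>, coordinate 1 itself rules out the other alternative.\<close>
  have split: "(\<forall>i\<in>{1..p}. even (P 1 + P i - int (e i))) \<longleftrightarrow>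
      (\<forall>i\<in>{1..p}. even (P i - int (e i))) \<or> (\<forall>i\<in>{1..p}. even (P i - int (e i + 1)))"
    (is "?L \<longleftrightarrow> ?E \<or> ?O") for P :: "nat \<Rightarrow> int"
  proof (cases "even (P 1)")
    case True
    then have "\<not> ?O" using one by force
    moreover have "?L \<longleftrightarrow> ?E" using True by simp
    ultimately show ?thesis by blast
  next
    case False
    then have "\<not> ?E" using one by force
    moreover have "?L \<longleftrightarrow> ?O" using False by auto
    ultimately show ?thesis by blast
  qed
  have box: "P \<in> (\<Pi>\<^sub>E i\<in>{1..p}. parity_range (m i) (k i)) \<longleftrightarrow>
      P \<in> grid p m \<and> (\<forall>i\<in>{1..p}. even (P i - int (k i)))" for P k
    by (auto simp: grid_def parity_range_def PiE_iff)
  show ?thesis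
    unfolding set_eq_iff Un_iff box index_class_def mem_Collect_eq idx split by blast
qed

lemma card_index_class:
  fixes p m \<delta>
  defines "e \<equiv> \<lambda>i. (\<delta>(0 := 0)) (i - 1)"
  assumes "p \<ge> 2" "\<delta> \<in> {1..p - 1} \<rightarrow>\<^sub>E {0, 1}"
  shows "real (card (index_class p m \<delta>)) =
    (\<Prod>i=1..p. (real (m i + 1) + (-1) ^ e i * real (res2 (int (m i + 1)))) / 2) +
    (\<Prod>i=1..p. (real (m i + 1) + (-1) ^ (e i + 1) * real (res2 (int (m i + 1)))) / 2)"
proof -
  \<comment> \<open>The shift \<open>k\<close>, 0 or 1, treats both boxes uniformly; they are
    disjoint because they demand opposite parities of coordinate 1.\<close>
  let ?A = "\<lambda>k. \<Pi>\<^sub>E i\<in>{1..p}. parity_range (m i) (e i + k)"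
  have disj: "?A 0 \<inter> ?A 1 = {}"
  proof (rule ccontr)
    assume "?A 0 \<inter> ?A 1 \<noteq> {}"
    then obtain P where "P \<in> ?A 0" "P \<in> ?A 1" by blast
    moreover have "1 \<in> {1..p}" using assms(2) by auto
    ultimately have "P 1 \<in> parity_range (m 1) (e 1 + 0)" "P 1 \<in> parity_range (m 1) (e 1 + 1)"
      by (meson PiE_mem)+
    then show False by (simp add: parity_range_def)
  qed
  have fin: "finite (?A k)" for k
    by (intro finite_PiE) (rule finite_atLeastAtMost finite_parity_range)+
  have card_box: "real (card (?A k)) =
    (\<Prod>i=1..p. (real (m i + 1) + (-1) ^ (e i + k) * real (res2 (int (m i + 1)))) / 2)" for k
    by (simp only: card_PiE finite_atLeastAtMost of_nat_prod card_parity_range)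
  have "index_class p m \<delta> = ?A 0 \<union> ?A 1"
    using index_class_eq_parity_boxes[OF assms(2,3)] by (simp add: e_def)
  then have "real (card (index_class p m \<delta>)) = real (card (?A 0)) + real (card (?A 1))"
    using card_Un_disjoint[OF fin fin disj] by (simp only: of_nat_add)
  then show ?thesis unfolding card_box by (simp only: add_0_right)
qed

theorem theorem4p18:
  fixes p :: nat and m :: "nat \<Rightarrow> nat"
  assumes "p \<ge> 2" and "\<forall>i\<in>{1..p}. m i > 0"
  shows "partition_on (grid p m) (orbits p m) \<and>
    card (orbits p m) = 2 ^ (p - 1) \<and>
    (\<forall>C\<in>orbits p m. \<forall>P\<in>C. \<forall>Q\<in>C. index p P = index p Q) \<and>
    (\<forall>\<delta> \<in> {1..p - 1} \<rightarrow>\<^sub>E {0, 1}.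
       index_class p m \<delta> \<in> orbits p m \<and>
       real (card (index_class p m \<delta>)) =
         (\<Prod>i=1..p. (real (m i + 1)
             + (-1) ^ res2 (int ((\<delta>(0 := 0)) (i - 1))) * real (res2 (int (m i + 1)))) / 2) +
         (\<Prod>i=1..p. (real (m i + 1)
             + (-1) ^ res2 (int ((\<delta>(0 := 0)) (i - 1)) + 1) * real (res2 (int (m i + 1)))) / 2))"
proof (intro conjI ballI)
  show "partition_on (grid p m) (orbits p m)" by (rule partition_on_orbits)
  show "card (orbits p m) = 2 ^ (p - 1)" by (rule card_orbits[OF assms(2)])
  show "index p P = index p Q" if "C \<in> orbits p m" "P \<in> C" "Q \<in> C" for C P Q
    using that unfolding orbits_eq_index_classes[OF assms(2)] by (auto simp: index_class_def)
  fix \<delta> :: "nat \<Rightarrow> nat" assume \<delta>: "\<delta> \<in> {1..p - 1} \<rightarrow>\<^sub>E {0, 1}"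
  then show "index_class p m \<delta> \<in> orbits p m"
    unfolding orbits_eq_index_classes[OF assms(2)] by blast
  have sgn: "(-1 :: real) ^ res2 (int k) = (-1) ^ k" for k
    by (simp add: res2_of_nat minus_one_power_iff)
  have sgn_Suc: "(-1 :: real) ^ res2 (int k + 1) = (-1) ^ (k + 1)" for k
    using sgn[of "k + 1"] by (simp add: add.commute)
  show "real (card (index_class p m \<delta>)) =
         (\<Prod>i=1..p. (real (m i + 1)
             + (-1) ^ res2 (int ((\<delta>(0 := 0)) (i - 1))) * real (res2 (int (m i + 1)))) / 2) +
         (\<Prod>i=1..p. (real (m i + 1)
             + (-1) ^ res2 (int ((\<delta>(0 := 0)) (i - 1)) + 1) * real (res2 (int (m i + 1)))) / 2)"
    unfolding sgn sgn_Suc by (rule card_index_class[OF assms(1) \<delta>])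
qed

end
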